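(* Let $Y$ be an invariant set and let $X$ be a finitely supported subset of $Y$ such that $X$ is not FSM uniformly infinite. Then the set $\wp_{us}(X)$ (regarded as a finitely supported subset of the invariant set $\wp_{fs}(Y)$) is not FSM uniformly infinite, i.e. $\wp_{us}(X)$ has no infinite subset all of whose elements are supported by one common finite set of atoms.
   Context: Fix an infinite set $A$ whose elements are called atoms. $S_A$ is the group of all bijections of $A$ that are compositions of finitely many transpositions $(a\,b)$. An $S_A$-set is a set with a group action $\cdot$ of $S_A$. For $S\subseteq A$, $Fix(S)=\{\pi\in S_A:\pi(a)=a\ \forall a\in S\}$; $S$ supports $x$ if $\pi\cdot x=x$ for all $\pi\in Fix(S)$; if $x$ has a finite supporting set, the least finite supporting set exists and is denoted $supp(x)$. An invariant set is an $S_A$-set in which every element has a finite supporting set. For an $S_A$-set $Y$, the powerset carries the action $\pi\star Z=\{\pi\cdot z: z\in Z\}$, and $\wp_{fs}(Y)$ denotes the set of subsets of $Y$ that are finitely supported with respect to $\star$; for $Y$ invariant, $\wp_{fs}(Y)$ is an invariant set. A finitely supported subset of $Y$ is an element of $\wp_{fs}(Y)$. A set $Z$ is uniformly supported if there is a finite $S\subseteq A$ supporting every element of $Z$. For $X\in\wp_{fs}(Y)$, $\wp_{us}(X)$ is the set of all uniformly supported subsets of $X$ (including $\emptyset$); it is a subset of $\wp_{fs}(Y)$ supported by $supp(X)$. A finitely supported subset $X$ of an invariant set is called FSM uniformly infinite if it contains an infinite uniformly supported subset, and FSM non-uniformly infinite otherwise. *)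

theory Defs
  imports "HOL-Algebra.Group_Action" "HOL-Combinatorics.Permutations"
begin

text \<open>
  The atoms are the elements of the type \<open>'a\<close>; that there are infinitely many of them is an
  explicit hypothesis wherever it is needed. The library predicate \<^const>\<open>permutation\<close> says that a
  map is a composition of finitely many transpositions.
\<close>

definition atom_group :: "('a \<Rightarrow> 'a) monoid"
  where "atom_group = \<lparr>carrier = {\<pi>. permutation \<pi>}, monoid.mult = (\<circ>), one = id\<rparr>"

definition Fix :: "'a set \<Rightarrow> ('a \<Rightarrow> 'a) set"
  where "Fix S = {\<pi> \<in> carrier atom_group. \<forall>a\<in>S. \<pi> a = a}"

definition supports :: "(('a \<Rightarrow> 'a) \<Rightarrow> 'b \<Rightarrow> 'b) \<Rightarrow> 'a set \<Rightarrow> 'b \<Rightarrow> bool"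
  where "supports \<phi> S x \<longleftrightarrow> (\<forall>\<pi>\<in>Fix S. \<phi> \<pi> x = x)"

definition finitely_supported :: "(('a \<Rightarrow> 'a) \<Rightarrow> 'b \<Rightarrow> 'b) \<Rightarrow> 'b \<Rightarrow> bool"
  where "finitely_supported \<phi> x \<longleftrightarrow> (\<exists>S. finite S \<and> supports \<phi> S x)"

definition uniformly_supported :: "(('a \<Rightarrow> 'a) \<Rightarrow> 'b \<Rightarrow> 'b) \<Rightarrow> 'b set \<Rightarrow> bool"
  where "uniformly_supported \<phi> Z \<longleftrightarrow> (\<exists>S. finite S \<and> (\<forall>z\<in>Z. supports \<phi> S z))"

locale invariant_set = group_action atom_group Y \<phi>
  for Y :: "'b set" and \<phi> :: "('a \<Rightarrow> 'a) \<Rightarrow> 'b \<Rightarrow> 'b" +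
  assumes finitely_supported: "y \<in> Y \<Longrightarrow> finitely_supported \<phi> y"

text \<open>
  Actions in the sense of \<^locale>\<open>group_action\<close> are extensional on their carrier, hence the
  \<open>restrict\<close> in the following definitions.
\<close>

definition pow_action ::
    "'b set \<Rightarrow> (('a \<Rightarrow> 'a) \<Rightarrow> 'b \<Rightarrow> 'b) \<Rightarrow> ('a \<Rightarrow> 'a) \<Rightarrow> 'b set \<Rightarrow> 'b set"
  where "pow_action Y \<phi> \<pi> = (\<lambda>Z\<in>Pow Y. \<phi> \<pi> ` Z)"

definition pow_fs :: "'b set \<Rightarrow> (('a \<Rightarrow> 'a) \<Rightarrow> 'b \<Rightarrow> 'b) \<Rightarrow> 'b set set"
  where "pow_fs Y \<phi> = {Z \<in> Pow Y. finitely_supported (pow_action Y \<phi>) Z}"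

definition pow_fs_action ::
    "'b set \<Rightarrow> (('a \<Rightarrow> 'a) \<Rightarrow> 'b \<Rightarrow> 'b) \<Rightarrow> ('a \<Rightarrow> 'a) \<Rightarrow> 'b set \<Rightarrow> 'b set"
  where "pow_fs_action Y \<phi> \<pi> = restrict (pow_action Y \<phi> \<pi>) (pow_fs Y \<phi>)"

definition pow_us :: "(('a \<Rightarrow> 'a) \<Rightarrow> 'b \<Rightarrow> 'b) \<Rightarrow> 'b set \<Rightarrow> 'b set set"
  where "pow_us \<phi> X = {Z. Z \<subseteq> X \<and> uniformly_supported \<phi> Z}"

text \<open>Meant for \<open>X \<in> pow_fs Y \<phi>\<close> where \<open>\<phi>\<close> is the action on an invariant set \<open>Y\<close>.\<close>

definition FSM_uniformly_infinite :: "(('a \<Rightarrow> 'a) \<Rightarrow> 'b \<Rightarrow> 'b) \<Rightarrow> 'b set \<Rightarrow> bool"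
  where "FSM_uniformly_infinite \<phi> X \<longleftrightarrow> (\<exists>Z. Z \<subseteq> X \<and> infinite Z \<and> uniformly_supported \<phi> Z)"


subsection \<open>Well-definedness\<close>

lemma carrier_atom_group [simp]: "\<pi> \<in> carrier atom_group \<longleftrightarrow> permutation \<pi>"
  and mult_atom_group [simp]: "monoid.mult atom_group = (\<circ>)"
  and one_atom_group [simp]: "one atom_group = id"
  by (simp_all add: atom_group_def)

lemma group_atom_group: "group atom_group"
proof (rule groupI)
  fix \<pi> :: "'a \<Rightarrow> 'a" assume "\<pi> \<in> carrier atom_group"
  then have "permutation (inv_into UNIV \<pi>)" "inv_into UNIV \<pi> \<circ> \<pi> = id"
    by (auto simp: permutation_inverse permutation_inverse_works)
  then show "\<exists>\<sigma>\<in>carrier atom_group. \<sigma> \<otimes>\<^bsub>atom_group\<^esub> \<pi> = \<one>\<^bsub>atom_group\<^esub>"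
    by auto
qed (auto simp: permutation_compose comp_assoc)

lemma atom_group_actionI:
  assumes "\<And>\<pi>. permutation \<pi> \<Longrightarrow> \<phi> \<pi> \<in> Bij E"
    and "\<And>\<pi> \<sigma>. permutation \<pi> \<Longrightarrow> permutation \<sigma> \<Longrightarrow> \<phi> (\<pi> \<circ> \<sigma>) = compose E (\<phi> \<pi>) (\<phi> \<sigma>)"
  shows "group_action atom_group E \<phi>"
  unfolding group_action_def group_hom_def group_hom_axioms_def
proof (intro conjI)
  show "\<phi> \<in> hom atom_group (BijGroup E)"
    using assms by (auto simp: hom_def BijGroup_def)
qed (rule group_atom_group group_BijGroup)+

lemma action_comp:
  assumes "group_action atom_group Y \<phi>" "permutation \<pi>" "permutation \<sigma>" "x \<in> Y"
  shows "\<phi> (\<pi> \<circ> \<sigma>) x = \<phi> \<pi> (\<phi> \<sigma> x)"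
  using group_action.composition_rule[OF assms(1,4), of \<pi> \<sigma>] assms(2,3) by simp

lemma action_closed:
  assumes "group_action atom_group Y \<phi>" "permutation \<pi>" "x \<in> Y"
  shows "\<phi> \<pi> x \<in> Y"
  using group_action.surj_prop[OF assms(1), of \<pi>] assms(2,3) by auto

lemma action_id:
  assumes "group_action atom_group Y \<phi>" "x \<in> Y"
  shows "\<phi> id x = x"
  using group_action.id_eq_one[OF assms(1)] assms(2) by (metis one_atom_group restrict_apply')

lemma supports_image:
  assumes act: "group_action atom_group Y \<phi>" and \<pi>: "permutation \<pi>" and x: "x \<in> Y"
    and S: "supports \<phi> S x"
  shows "supports \<phi> (\<pi> ` S) (\<phi> \<pi> x)"
  unfolding supports_def
proof
  fix \<sigma> assume "\<sigma> \<in> Fix (\<pi> ` S)"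
  then have \<sigma>: "permutation \<sigma>" "\<And>a. a \<in> S \<Longrightarrow> \<sigma> (\<pi> a) = \<pi> a"
    by (auto simp: Fix_def)
  have inv: "permutation (inv_into UNIV \<pi>)" "inv_into UNIV \<pi> \<circ> \<pi> = id" "\<pi> \<circ> inv_into UNIV \<pi> = id"
    using \<pi> by (auto simp: permutation_inverse permutation_inverse_works)
  define \<tau> where "\<tau> = inv_into UNIV \<pi> \<circ> (\<sigma> \<circ> \<pi>)"
  have \<tau>: "permutation \<tau>"
    unfolding \<tau>_def using \<pi> \<sigma>(1) inv(1) by (intro permutation_compose)
  have "\<tau> a = a" if "a \<in> S" for a
    using \<sigma>(2)[OF that] inv(2) by (simp add: \<tau>_def fun_eq_iff)
  then have "\<phi> \<tau> x = x"
    using S \<tau> by (auto simp: supports_def Fix_def)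
  moreover have "\<sigma> \<circ> \<pi> = \<pi> \<circ> \<tau>"
    unfolding \<tau>_def by (metis comp_assoc inv(3) id_comp)
  ultimately show "\<phi> \<sigma> (\<phi> \<pi> x) = \<phi> \<pi> x"
    using action_comp[OF act \<sigma>(1) \<pi> x] action_comp[OF act \<pi> \<tau> x] by simp
qed

lemma invariant_set_finitely_supported_part:
  fixes \<phi> :: "('a \<Rightarrow> 'a) \<Rightarrow> 'b \<Rightarrow> 'b"
  assumes act: "group_action atom_group Y \<phi>"
  defines "F \<equiv> {x \<in> Y. finitely_supported \<phi> x}"
  shows "invariant_set F (\<lambda>\<pi>. restrict (\<phi> \<pi>) F)"
proof -
  have closed: "\<phi> \<pi> x \<in> F" if "permutation \<pi>" "x \<in> F" for \<pi> x
    using that supports_image[OF act that(1), of x] action_closed[OF act that(1), of x]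
    unfolding F_def finitely_supported_def by blast
  have "group_action atom_group F (\<lambda>\<pi>. restrict (\<phi> \<pi>) F)"
  proof (rule atom_group_actionI)
    fix \<pi> :: "'a \<Rightarrow> 'a" assume \<pi>: "permutation \<pi>"
    have inv: "permutation (inv_into UNIV \<pi>)" "inv_into UNIV \<pi> \<circ> \<pi> = id" "\<pi> \<circ> inv_into UNIV \<pi> = id"
      using \<pi> by (auto simp: permutation_inverse permutation_inverse_works)
    have FY: "x \<in> Y" if "x \<in> F" for x using that by (simp add: F_def)
    have "bij_betw (\<phi> \<pi>) F F"
    proof (rule bij_betw_byWitness[where f' = "\<phi> (inv_into UNIV \<pi>)"])
      show "\<forall>x\<in>F. \<phi> (inv_into UNIV \<pi>) (\<phi> \<pi> x) = x"
        using action_comp[OF act inv(1) \<pi>] action_id[OF act] inv(2) FY by metis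
      show "\<forall>x\<in>F. \<phi> \<pi> (\<phi> (inv_into UNIV \<pi>) x) = x"
        using action_comp[OF act \<pi> inv(1)] action_id[OF act] inv(3) FY by metis
    qed (use closed \<pi> inv(1) in auto)
    then show "restrict (\<phi> \<pi>) F \<in> Bij F"
      by (auto simp: Bij_def cong: bij_betw_cong)
  next
    fix \<pi> \<sigma> :: "'a \<Rightarrow> 'a" assume "permutation \<pi>" "permutation \<sigma>"
    then show "restrict (\<phi> (\<pi> \<circ> \<sigma>)) F = compose F (restrict (\<phi> \<pi>) F) (restrict (\<phi> \<sigma>) F)"
      using closed action_comp[OF act, of \<pi> \<sigma>] by (auto simp: fun_eq_iff compose_def F_def)
  qed
  moreover have "finitely_supported (\<lambda>\<pi>. restrict (\<phi> \<pi>) F) x" if "x \<in> F" for x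
    using that by (auto simp: F_def finitely_supported_def supports_def)
  ultimately show ?thesis
    by (simp add: invariant_set_def invariant_set_axioms_def)
qed

lemma group_action_pow_action:
  assumes act: "group_action atom_group Y \<phi>"
  shows "group_action atom_group (Pow Y) (pow_action Y \<phi>)"
proof (rule atom_group_actionI)
  fix \<pi> :: "'a \<Rightarrow> 'a" assume \<pi>: "permutation \<pi>"
  have "bij_betw (\<phi> \<pi>) Y Y"
    using group_action.bij_prop0[OF act, of \<pi>] \<pi> by (simp add: Bij_def)
  then have "bij_betw ((`) (\<phi> \<pi>)) (Pow Y) (Pow Y)"
    by (rule bij_betw_Pow)
  then have "bij_betw (pow_action Y \<phi> \<pi>) (Pow Y) (Pow Y)"
    by (subst bij_betw_cong[where g = "(`) (\<phi> \<pi>)"]) (auto simp: pow_action_def)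
  then show "pow_action Y \<phi> \<pi> \<in> Bij (Pow Y)"
    by (simp add: Bij_def pow_action_def)
next
  fix \<pi> \<sigma> :: "'a \<Rightarrow> 'a" assume *: "permutation \<pi>" "permutation \<sigma>"
  have "\<phi> (\<pi> \<circ> \<sigma>) ` Z = \<phi> \<pi> ` \<phi> \<sigma> ` Z" "\<phi> \<sigma> ` Z \<subseteq> Y" if "Z \<subseteq> Y" for Z
    using that action_comp[OF act *] action_closed[OF act *(2)]
    by (force simp: image_image intro!: image_cong)+
  then show "pow_action Y \<phi> (\<pi> \<circ> \<sigma>) = compose (Pow Y) (pow_action Y \<phi> \<pi>) (pow_action Y \<phi> \<sigma>)"
    by (auto simp: fun_eq_iff pow_action_def compose_def restrict_def)
qed

theorem invariant_set_pow_fs: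
  assumes "invariant_set Y \<phi>"
  shows "invariant_set (pow_fs Y \<phi>) (pow_fs_action Y \<phi>)"
proof -
  have "group_action atom_group Y \<phi>"
    using assms by (simp add: invariant_set_def)
  from invariant_set_finitely_supported_part[OF group_action_pow_action[OF this]]
  show ?thesis
    by (simp add: pow_fs_def pow_fs_action_def[abs_def])
qed

lemma pow_us_subset_pow_fs:
  assumes "X \<subseteq> Y"
  shows "pow_us \<phi> X \<subseteq> pow_fs Y \<phi>"
proof
  fix Z assume "Z \<in> pow_us \<phi> X"
  then obtain S where Z: "Z \<subseteq> Y" "finite S" "\<And>z. z \<in> Z \<Longrightarrow> supports \<phi> S z"
    using assms by (auto simp: pow_us_def uniformly_supported_def)
  then have "supports (pow_action Y \<phi>) S Z"
    by (auto simp: supports_def pow_action_def)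
  then show "Z \<in> pow_fs Y \<phi>"
    using Z by (auto simp: pow_fs_def finitely_supported_def)
qed

theorem pow_us_in_pow_fs_pow_fs:
  assumes inv: "invariant_set Y \<phi>" and X: "X \<in> pow_fs Y \<phi>"
  shows "pow_us \<phi> X \<in> pow_fs (pow_fs Y \<phi>) (pow_fs_action Y \<phi>)"
proof -
  have act: "group_action atom_group Y \<phi>"
    using inv by (simp add: invariant_set_def)
  have XY: "X \<subseteq> Y" using X by (simp add: pow_fs_def)
  obtain S where S: "finite S" "supports (pow_action Y \<phi>) S X"
    using X by (auto simp: pow_fs_def finitely_supported_def)
  have sub: "pow_us \<phi> X \<subseteq> pow_fs Y \<phi>" by (rule pow_us_subset_pow_fs[OF XY])
  have closed: "\<phi> \<pi> ` Z \<in> pow_us \<phi> X" if \<pi>: "\<pi> \<in> Fix S" and Z: "Z \<in> pow_us \<phi> X" for \<pi> Z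
  proof -
    have p: "permutation \<pi>" using \<pi> by (simp add: Fix_def)
    have "\<phi> \<pi> ` X = X"
      using S(2) \<pi> XY by (auto simp: supports_def pow_action_def)
    then have "\<phi> \<pi> ` Z \<subseteq> X" using Z by (auto simp: pow_us_def)
    moreover obtain T where "finite T" "\<forall>z\<in>Z. supports \<phi> T z"
      using Z by (auto simp: pow_us_def uniformly_supported_def)
    then have "finite (\<pi> ` T) \<and> (\<forall>z\<in>\<phi> \<pi> ` Z. supports \<phi> (\<pi> ` T) z)"
      using supports_image[OF act p] Z XY by (auto simp: pow_us_def)
    ultimately show ?thesis
      unfolding pow_us_def uniformly_supported_def by blast
  qed
  have "supports (pow_action (pow_fs Y \<phi>) (pow_fs_action Y \<phi>)) S (pow_us \<phi> X)"
    unfolding supports_def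
  proof
    fix \<pi> assume \<pi>: "\<pi> \<in> Fix S"
    have p: "permutation \<pi>" using \<pi> by (simp add: Fix_def)
    have pinv: "permutation (inv_into UNIV \<pi>)" "\<pi> \<circ> inv_into UNIV \<pi> = id"
      using p by (auto simp: permutation_inverse permutation_inverse_works)
    have i: "inv_into UNIV \<pi> \<in> Fix S"
      using \<pi> pinv(1) permutation_bijective[OF p] by (auto simp: Fix_def bij_is_inj inv_f_eq)
    have eq: "pow_fs_action Y \<phi> \<pi> Z = \<phi> \<pi> ` Z" if "Z \<in> pow_us \<phi> X" for Z
      using that sub by (auto simp: pow_fs_action_def pow_action_def pow_fs_def)
    have surj: "\<phi> \<pi> ` \<phi> (inv_into UNIV \<pi>) ` Z = Z" if "Z \<in> pow_us \<phi> X" for Z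
    proof -
      have "Z \<subseteq> Y" using that XY by (auto simp: pow_us_def)
      then have "\<phi> \<pi> (\<phi> (inv_into UNIV \<pi>) z) = z" if "z \<in> Z" for z
        using action_comp[OF act p pinv(1), of z] action_id[OF act, of z] pinv(2) that by auto
      then show ?thesis by (force simp: image_image)
    qed
    have "pow_fs_action Y \<phi> \<pi> ` pow_us \<phi> X = pow_us \<phi> X"
    proof
      show "pow_fs_action Y \<phi> \<pi> ` pow_us \<phi> X \<subseteq> pow_us \<phi> X"
        using eq closed[OF \<pi>] by auto
      show "pow_us \<phi> X \<subseteq> pow_fs_action Y \<phi> \<pi> ` pow_us \<phi> X"
        using eq surj closed[OF i] by (metis image_eqI subsetI)
    qed
    then show "pow_action (pow_fs Y \<phi>) (pow_fs_action Y \<phi>) \<pi> (pow_us \<phi> X) = pow_us \<phi> X"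
      using sub by (simp add: pow_action_def)
  qed
  then show ?thesis
    using S(1) sub by (auto simp: pow_fs_def[of "pow_fs Y \<phi>"] finitely_supported_def)
qed

end

theory Submission
  imports Defs
begin

text \<open>
  If a set \<open>Z\<close> is uniformly supported by \<open>T\<close> and, as a set, supported by \<open>S\<close>, then \<open>S\<close> supports
  every element of \<open>Z\<close>: a given \<open>\<pi> \<in> Fix S\<close> is conjugated by some \<open>\<sigma> \<in> Fix S\<close> that moves the
  atoms not fixed by \<open>\<pi>\<close> away from \<open>T\<close>; the conjugate fixes \<open>\<sigma> \<cdot> z \<in> Z\<close>, so \<open>\<pi>\<close> fixes \<open>z\<close>.
  Hence the union of a family of uniformly supported subsets of \<open>X\<close> with a common finite support
  is a uniformly supported subset of \<open>X\<close>, so it is finite, and so is the family.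
\<close>

text \<open>Swap \<open>M\<close> with an equally large set \<open>N\<close> of fresh atoms. That
  \<open>N\<close> misses \<open>M\<close> makes the swap an involution; that \<open>N\<close>, like
  \<open>M\<close>, misses \<open>S\<close> keeps \<open>S\<close> fixed pointwise; that
  \<open>N\<close> misses \<open>T\<close> gives the last property.\<close>

lemma ex_involution_avoiding:
  assumes "infinite (UNIV :: 'a set)" "finite S" "finite T" "finite M" "M \<inter> S = {}"
  obtains \<sigma> :: "'a \<Rightarrow> 'a"
  where "permutation \<sigma>" "\<sigma> \<circ> \<sigma> = id" "\<And>a. a \<in> S \<Longrightarrow> \<sigma> a = a" "\<sigma> ` M \<inter> T = {}"
proof -
  have "infinite (- (S \<union> T \<union> M))"
    using assms by (metis finite_Un finite_compl)
  then obtain N where N: "finite N" "card N = card M" "N \<subseteq> - (S \<union> T \<union> M)"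
    by (metis infinite_arbitrarily_large)
  then obtain f where f: "bij_betw f M N"
    using assms(4) by (metis finite_same_card_bij)
  define \<sigma> where "\<sigma> a = (if a \<in> M then f a else if a \<in> N then inv_into M f a else a)" for a
  have "\<sigma> (\<sigma> a) = a" for a
    using N(3) bij_betwE[OF f] bij_betwE[OF bij_betw_inv_into[OF f]]
      bij_betw_inv_into_left[OF f, of a] bij_betw_inv_into_right[OF f, of a]
    by (auto simp: \<sigma>_def)
  then have inv: "\<sigma> \<circ> \<sigma> = id" by auto
  have "finite {a. \<sigma> a \<noteq> a}"
    by (rule finite_subset[of _ "M \<union> N"]) (use assms(4) N(1) in \<open>auto simp: \<sigma>_def\<close>)
  then have "permutation \<sigma>"
    using o_bij[OF inv inv] by (simp add: permutation)
  moreover have "\<sigma> a = a" if "a \<in> S" for a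
    using that assms(5) N(3) by (auto simp: \<sigma>_def)
  moreover have "\<sigma> ` M \<inter> T = {}"
    using N(3) bij_betwE[OF f] by (auto simp: \<sigma>_def)
  ultimately show ?thesis using inv that by blast
qed

lemma supports_element_of_uniformly_supported:
  fixes \<phi> :: "('a \<Rightarrow> 'a) \<Rightarrow> 'b \<Rightarrow> 'b"
  assumes inf: "infinite (UNIV :: 'a set)"
    and act: "group_action atom_group Y \<phi>"
    and Z: "Z \<subseteq> Y" "uniformly_supported \<phi> Z"
    and S: "finite S" "supports (pow_action Y \<phi>) S Z"
    and z: "z \<in> Z"
  shows "supports \<phi> S z"
  unfolding supports_def
proof
  fix \<pi> :: "'a \<Rightarrow> 'a" assume "\<pi> \<in> Fix S"
  then have \<pi>: "permutation \<pi>" "\<And>a. a \<in> S \<Longrightarrow> \<pi> a = a"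
    by (auto simp: Fix_def)
  obtain T where T: "finite T" "\<And>w. w \<in> Z \<Longrightarrow> supports \<phi> T w"
    using Z(2) by (auto simp: uniformly_supported_def)
  define M where "M = {a. \<pi> a \<noteq> a}"
  have M: "finite M" "M \<inter> S = {}"
    using \<pi> by (auto simp: M_def permutation)
  obtain \<sigma> where \<sigma>: "permutation \<sigma>" "\<sigma> \<circ> \<sigma> = id" "\<And>a. a \<in> S \<Longrightarrow> \<sigma> a = a" "\<sigma> ` M \<inter> T = {}"
    using ex_involution_avoiding[OF inf S(1) T(1) M] by metis
  have \<sigma>\<sigma>: "\<sigma> (\<sigma> a) = a" for a
    using \<sigma>(2) by (simp add: fun_eq_iff)
  have zY: "z \<in> Y" using z Z(1) by auto
  \<comment> \<open>The support of \<open>Z\<close> as a set keeps the moved element inside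
    \<open>Z\<close>, where \<open>T\<close> supports it.\<close>
  have "\<phi> \<sigma> ` Z = Z"
    using S(2) \<sigma>(1,3) Z(1) by (auto simp: supports_def Fix_def pow_action_def)
  then have w: "\<phi> \<sigma> z \<in> Z" "\<phi> \<sigma> z \<in> Y" using z Z(1) by auto
  define \<rho> where "\<rho> = \<sigma> \<circ> (\<pi> \<circ> \<sigma>)"
  have \<rho>: "permutation \<rho>"
    unfolding \<rho>_def by (intro permutation_compose \<sigma>(1) \<pi>(1))
  have "\<rho> a = a" if "a \<in> T" for a
  proof -
    have "\<sigma> a \<notin> M"
      using \<sigma>(4) that \<sigma>\<sigma> by (metis disjoint_iff image_eqI)
    then show ?thesis by (simp add: \<rho>_def M_def \<sigma>\<sigma>)
  qed
  then have fixed: "\<phi> \<rho> (\<phi> \<sigma> z) = \<phi> \<sigma> z"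
    using T(2)[OF w(1)] \<rho> by (auto simp: supports_def Fix_def)
  have "\<pi> = \<sigma> \<circ> (\<rho> \<circ> \<sigma>)"
    by (simp add: \<rho>_def fun_eq_iff \<sigma>\<sigma>)
  then have "\<phi> \<pi> z = \<phi> \<sigma> (\<phi> \<rho> (\<phi> \<sigma> z))"
    using action_comp[OF act \<sigma>(1) permutation_compose[OF \<rho> \<sigma>(1)] zY]
      action_comp[OF act \<rho> \<sigma>(1) zY] by simp
  also have "\<dots> = z"
    using fixed action_comp[OF act \<sigma>(1) \<sigma>(1) zY] action_id[OF act zY] \<sigma>(2) by simp
  finally show "\<phi> \<pi> z = z" .
qed

theorem theorem3p2:
  fixes Y X :: "'b set" and \<phi> :: "('a \<Rightarrow> 'a) \<Rightarrow> 'b \<Rightarrow> 'b"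
  assumes "infinite (UNIV :: 'a set)"
    and "invariant_set Y \<phi>"
    and "X \<in> pow_fs Y \<phi>"
    and "\<not> FSM_uniformly_infinite \<phi> X"
  shows "\<not> FSM_uniformly_infinite (pow_fs_action Y \<phi>) (pow_us \<phi> X)"
proof
  assume "FSM_uniformly_infinite (pow_fs_action Y \<phi>) (pow_us \<phi> X)"
  then obtain F S where F: "F \<subseteq> pow_us \<phi> X" "infinite F"
    and S: "finite S" "\<And>Z. Z \<in> F \<Longrightarrow> supports (pow_fs_action Y \<phi>) S Z"
    by (auto simp: FSM_uniformly_infinite_def uniformly_supported_def)
  have act: "group_action atom_group Y \<phi>"
    using assms(2) by (simp add: invariant_set_def)
  have XY: "X \<subseteq> Y" using assms(3) by (simp add: pow_fs_def)
  have "supports \<phi> S z" if "Z \<in> F" "z \<in> Z" for Z z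
  proof (rule supports_element_of_uniformly_supported[OF assms(1) act _ _ S(1) _ that(2)])
    show "Z \<subseteq> Y" "uniformly_supported \<phi> Z"
      using that(1) F(1) XY by (auto simp: pow_us_def)
    \<comment> \<open>Inside \<open>pow_fs Y \<phi>\<close> the restriction in
      \<open>pow_fs_action\<close> has no effect, so the support carries over to
      \<open>pow_action\<close>.\<close>
    have "Z \<in> pow_fs Y \<phi>"
      using that(1) F(1) pow_us_subset_pow_fs[OF XY] by blast
    then show "supports (pow_action Y \<phi>) S Z"
      using S(2)[OF that(1)] by (simp add: supports_def pow_fs_action_def)
  qed
  then have "uniformly_supported \<phi> (\<Union>F)"
    using S(1) by (auto simp: uniformly_supported_def)
  moreover have "\<Union>F \<subseteq> X" using F(1) by (auto simp: pow_us_def)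
  ultimately have "finite (\<Union>F)"
    using assms(4) by (auto simp: FSM_uniformly_infinite_def)
  \<comment> \<open>\<open>F\<close> consists of subsets of the finite set \<open>\<Union>F\<close>,
    so it is finite.\<close>
  then show False using F(2) by (simp add: finite_UnionD)
qed

end
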